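(* Let $N=2$ (and multiplicity function $k=0$). For $z\in\mathbb{C}$ with $\operatorname{Re}z>0$, the integral kernel $K_0$ of $\exp(z|x|^2\Delta)$ satisfies $$K_0(r\omega,r'\omega';z)=\frac{1}{2\pi\sqrt{4\pi z}}\exp\Bigl(-\frac{(\log r-\log r')^2}{4z}\Bigr)\vartheta\Bigl(\frac1{2\pi}\arccos\langle\omega,\omega'\rangle,\frac{\mathrm{i}}{\pi}z\Bigr)$$ for all $r,r'\in\mathbb{R}_{>0}$ and $\omega,\omega'\in S^1$. Equivalently (identifying $\mathbb{R}^2$ with $\mathbb{C}$), $$K_0(re^{\mathrm{i}\phi},r'e^{\mathrm{i}\phi'};z)=\frac{1}{2\pi\sqrt{4\pi z}}\exp\Bigl(-\frac{(\log r-\log r')^2}{4z}\Bigr)\vartheta\Bigl(\frac1{2\pi}(\phi-\phi'),\frac{\mathrm{i}}{\pi}z\Bigr)$$ for all $r,r'\in\mathbb{R}_{>0}$ and $\phi,\phi'\in\mathbb{R}$.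
   Context: The branch of $\sqrt z$ is such that $\sqrt z>0$ when $z>0$. The theta function is $$\vartheta(v,\tau)=\sum_{m=-\infty}^\infty\exp(\mathrm{i}\pi\tau m^2+2\mathrm{i}\pi mv)=1+2\sum_{m=1}^\infty\exp(\mathrm{i}\pi\tau m^2)\cos2\pi mv.$$ $\Delta$ is the classical Laplacian on $\mathbb{R}^2$. Let $\mathcal{H}^m(S^1)$ be the space of classical spherical harmonics of degree $m$ on $S^1$ (restrictions of homogeneous harmonic polynomials of degree $m$), and let $P_0^{(m)}(\omega,\omega')=2\pi\sum_jp_j(\omega)\overline{p_j(\omega')}$ for any orthonormal basis $(p_j)$ of $\mathcal{H}^m(S^1)\subset L^2(S^1,d\omega)$, where $d\omega$ is arc length, of total mass $2\pi$. For $\operatorname{Re}z>0$, $r,r'>0$, $\omega,\omega'\in S^1$, the kernel is defined by $$K_0(r\omega,r'\omega';z)=\frac{1}{\sqrt{4\pi z}}\exp\Bigl(-\frac{(\log r-\log r')^2}{4z}\Bigr)\cdot\frac{1}{2\pi}\sum_{m=0}^\infty\exp(-zm^2)P_0^{(m)}(\omega,\omega');$$ it is the integral kernel, with respect to $|x'|^{-2}dx'$, of the bounded operator $\exp(z|x|^2\Delta)$ on $L^2(\mathbb{R}^2,|x|^{-2}dx)$. *)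

theory Defs
  imports "HOL-Analysis.Analysis"
begin

definition partial_deriv :: "'n \<Rightarrow> (real ^ 'n \<Rightarrow> complex) \<Rightarrow> real ^ 'n \<Rightarrow> complex" where
  "partial_deriv i f x = vector_derivative (\<lambda>t. f (x + t *\<^sub>R axis i 1)) (at 0)"

definition laplacian :: "(real ^ 'n \<Rightarrow> complex) \<Rightarrow> real ^ 'n \<Rightarrow> complex" where
  "laplacian f x = (\<Sum>i\<in>UNIV. partial_deriv i (partial_deriv i f) x)"

abbreviation S1 :: "(real ^ 2) set" where
  "S1 \<equiv> sphere 0 1"

text \<open>The identification of the complex plane with the Euclidean plane.\<close>
definition plane :: "complex \<Rightarrow> real ^ 2" where
  "plane w = vector [Re w, Im w]"

definition arc_length :: "(real ^ 2) measure" where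
  "arc_length = distr (restrict_space lborel {0..<2 * pi}) borel (\<lambda>t. plane (cis t))"

definition homogeneous_polynomial :: "nat \<Rightarrow> (real ^ 2 \<Rightarrow> complex) \<Rightarrow> bool" where
  "homogeneous_polynomial m p \<longleftrightarrow>
    (\<exists>a :: nat \<Rightarrow> complex. \<forall>x. p x = (\<Sum>i\<le>m. a i * of_real (x $ 1) ^ i * of_real (x $ 2) ^ (m - i)))"

text \<open>Functions on the circle are represented as extensional functions (\<^const>\<open>restrict\<close>), so that
  functions agreeing on the circle are equal.\<close>
definition spherical_harmonics :: "nat \<Rightarrow> (real ^ 2 \<Rightarrow> complex) set" where
  "spherical_harmonics m =
    {restrict p S1 | p. homogeneous_polynomial m p \<and> (\<forall>x. laplacian p x = 0)}"

definition L2_inner :: "(real ^ 2 \<Rightarrow> complex) \<Rightarrow> (real ^ 2 \<Rightarrow> complex) \<Rightarrow> complex" where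
  "L2_inner f g = (LINT \<omega>|arc_length. f \<omega> * cnj (g \<omega>))"

definition orthonormal_basis :: "nat \<Rightarrow> (real ^ 2 \<Rightarrow> complex) set \<Rightarrow> bool" where
  "orthonormal_basis m B \<longleftrightarrow>
    finite B \<and> B \<subseteq> spherical_harmonics m \<and>
    (\<forall>p\<in>B. \<forall>q\<in>B. L2_inner p q = (if p = q then 1 else 0)) \<and>
    (\<forall>h\<in>spherical_harmonics m. \<exists>c. \<forall>\<omega>\<in>S1. h \<omega> = (\<Sum>p\<in>B. c p * p \<omega>))"

text \<open>The value does not depend on the orthonormal basis; the definite description picks the common
  value over all of them.\<close>
definition P0 :: "nat \<Rightarrow> real ^ 2 \<Rightarrow> real ^ 2 \<Rightarrow> complex" where
  "P0 m \<omega> \<omega>' =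
    (THE v. \<exists>B. orthonormal_basis m B \<and> v = 2 * of_real pi * (\<Sum>p\<in>B. p \<omega> * cnj (p \<omega>')))"

text \<open>Polar coordinates of \<open>x \<noteq> 0\<close> are \<open>norm x\<close> and \<open>sgn x = x /\<^sub>R norm x\<close>.\<close>
definition K0 :: "real ^ 2 \<Rightarrow> real ^ 2 \<Rightarrow> complex \<Rightarrow> complex" where
  "K0 x x' z =
    1 / csqrt (4 * of_real pi * z) * exp (- (of_real ((ln (norm x) - ln (norm x'))\<^sup>2) / (4 * z))) *
    (1 / (2 * of_real pi) * (\<Sum>m. exp (- (z * of_nat m ^ 2)) * P0 m (sgn x) (sgn x')))"

definition theta :: "complex \<Rightarrow> complex \<Rightarrow> complex" where
  "theta v \<tau> =
    (\<Sum>\<^sub>\<infinity>m\<in>(UNIV :: int set). exp (\<i> * of_real pi * \<tau> * of_int m ^ 2 + 2 * \<i> * of_real pi * of_int m * v))"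

end

theory Submission imports Defs
begin

text \<open>In the coordinates \<open>w = x\<^sub>1 + \<i> x\<^sub>2\<close> and \<open>cnj w\<close> a homogeneous polynomial of degree \<open>m\<close> is
  harmonic only if it is a combination of \<open>w\<^sup>m\<close> and \<open>cnj w\<^sup>m\<close>. Hence \<open>e\<^bsup>\<i>kt\<^esup> / \<surd>(2\<pi>)\<close> with
  \<open>k = \<plusminus>m\<close> is an orthonormal basis of the spherical harmonics of degree \<open>m\<close>, the zonal kernel
  \<open>P0 m\<close> is the sum of \<open>e\<^bsup>\<i>k(t - t')\<^esup>\<close> over \<open>k = \<plusminus>m\<close>, and the series defining \<open>K0\<close> is the
  theta series with the terms of index \<open>k\<close> and \<open>-k\<close> grouped together. Since the zonal kernel only
  depends on \<open>cos (t - t')\<close>, the angle may be replaced by \<open>arccos\<close> of the inner product.\<close>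

section \<open>Binary forms and linear changes of variables\<close>

text \<open>\<open>u\<close> and \<open>v\<close> are arbitrary functions, so that the real
  coordinates and the pair w, cnj w fall under one notion.\<close>

definition binary_form ::
  "nat \<Rightarrow> ('a \<Rightarrow> complex) \<Rightarrow> ('a \<Rightarrow> complex) \<Rightarrow> ('a \<Rightarrow> complex) \<Rightarrow> bool" where
  "binary_form m u v p \<longleftrightarrow> (\<exists>a. \<forall>x. p x = (\<Sum>i\<le>m. a i * u x ^ i * v x ^ (m - i)))"

lemma binary_formI:
  "(\<And>x. p x = (\<Sum>i\<le>m. a i * u x ^ i * v x ^ (m - i))) \<Longrightarrow> binary_form m u v p"
  unfolding binary_form_def by blast

lemma homogeneous_polynomial_iff_binary_form:
  "homogeneous_polynomial m p \<longleftrightarrow>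
    binary_form m (\<lambda>x. of_real (x $ 1)) (\<lambda>x. of_real (x $ 2)) p"
  by (simp add: homogeneous_polynomial_def binary_form_def)

lemma binary_form_cmult:
  assumes "binary_form m u v p"
  shows "binary_form m u v (\<lambda>x. c * p x)"
proof -
  obtain a where "\<forall>x. p x = (\<Sum>i\<le>m. a i * u x ^ i * v x ^ (m - i))"
    using assms by (auto simp: binary_form_def)
  then have "c * p x = (\<Sum>i\<le>m. (c * a i) * u x ^ i * v x ^ (m - i))" for x
    by (simp add: sum_distrib_left mult.assoc)
  then show ?thesis
    by (rule binary_formI)
qed

lemma binary_form_add:
  assumes "binary_form m u v p" "binary_form m u v q"
  shows "binary_form m u v (\<lambda>x. p x + q x)"
proof -
  obtain a b where "\<forall>x. p x = (\<Sum>i\<le>m. a i * u x ^ i * v x ^ (m - i))"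
    and "\<forall>x. q x = (\<Sum>i\<le>m. b i * u x ^ i * v x ^ (m - i))"
    using assms by (auto simp: binary_form_def)
  then have "p x + q x = (\<Sum>i\<le>m. (a i + b i) * u x ^ i * v x ^ (m - i))" for x
    by (simp add: sum.distrib distrib_right)
  then show ?thesis
    by (rule binary_formI)
qed

lemma binary_form_zero: "binary_form m u v (\<lambda>x. 0)"
  unfolding binary_form_def by (intro exI[of _ "\<lambda>_. 0"]) simp

lemma binary_form_sum:
  assumes "\<And>i. i \<in> I \<Longrightarrow> binary_form m u v (p i)"
  shows "binary_form m u v (\<lambda>x. \<Sum>i\<in>I. p i x)"
  using assms
  by (induction I rule: infinite_finite_induct) (simp_all add: binary_form_zero binary_form_add)

lemma binary_form_mult_left:
  assumes "binary_form m u v p"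
  shows "binary_form (Suc m) u v (\<lambda>x. u x * p x)"
proof -
  obtain a where "\<forall>x. p x = (\<Sum>i\<le>m. a i * u x ^ i * v x ^ (m - i))"
    using assms by (auto simp: binary_form_def)
  then have "u x * p x =
      (\<Sum>i\<le>Suc m. (case i of 0 \<Rightarrow> 0 | Suc j \<Rightarrow> a j) * u x ^ i * v x ^ (Suc m - i))" for x
    by (simp add: sum.atMost_Suc_shift sum_distrib_left mult_ac del: sum.atMost_Suc)
  then show ?thesis
    by (rule binary_formI)
qed

lemma binary_form_mult_right:
  assumes "binary_form m u v p"
  shows "binary_form (Suc m) u v (\<lambda>x. v x * p x)"
proof -
  obtain a where "\<forall>x. p x = (\<Sum>i\<le>m. a i * u x ^ i * v x ^ (m - i))"
    using assms by (auto simp: binary_form_def)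
  \<comment> \<open>The values of \<open>a\<close> beyond \<open>m\<close> are arbitrary, so the new
    coefficient of index \<open>Suc m\<close> has to be set to 0.\<close>
  then have "v x * p x =
      (\<Sum>i\<le>Suc m. (if i \<le> m then a i else 0) * u x ^ i * v x ^ (Suc m - i))" for x
    by (auto simp: sum_distrib_left Suc_diff_le mult_ac intro!: sum.cong)
  then show ?thesis
    by (rule binary_formI)
qed

lemma binary_form_mult_linear:
  assumes "binary_form m u v p"
  shows "binary_form (Suc m) u v (\<lambda>x. (\<alpha> * u x + \<beta> * v x) * p x)"
  using binary_form_add[OF binary_form_cmult[OF binary_form_mult_left[OF assms], of \<alpha>]
      binary_form_cmult[OF binary_form_mult_right[OF assms], of \<beta>]]
  by (simp add: algebra_simps)

lemma binary_form_one: "binary_form 0 u v (\<lambda>x. 1)"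
  unfolding binary_form_def by (intro exI[of _ "\<lambda>_. 1"]) simp

text \<open>Each monomial is a product of \<open>m\<close> linear forms in \<open>u'\<close> and
  \<open>v'\<close>, so it is built up one factor at a time by
  \<open>binary_form_mult_linear\<close>.\<close>

lemma binary_form_change_of_variables:
  assumes "binary_form m u v p"
    and u: "\<And>x. u x = \<alpha> * u' x + \<beta> * v' x"
    and v: "\<And>x. v x = \<gamma> * u' x + \<delta> * v' x"
  shows "binary_form m u' v' p"
proof -
  obtain a where a: "\<And>x. p x = (\<Sum>i\<le>m. a i * u x ^ i * v x ^ (m - i))"
    using assms(1) by (auto simp: binary_form_def)
  have v_power: "binary_form k u' v' (\<lambda>x. v x ^ k)" for k
    by (induction k) (simp_all add: binary_form_one binary_form_mult_linear v)
  \<comment> \<open>Writing the degree as \<open>i + k\<close> keeps truncated subtraction out of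
    the induction; \<open>k = m - i\<close> is put in afterwards.\<close>
  have "binary_form (i + k) u' v' (\<lambda>x. u x ^ i * v x ^ k)" for i k
  proof (induction i)
    case 0
    then show ?case by (simp add: v_power)
  next
    case (Suc i)
    then show ?case
      using binary_form_mult_linear[OF Suc, of \<alpha> \<beta>] by (simp add: u mult.assoc)
  qed
  from this[of _ "m - _"] have monomial: "binary_form m u' v' (\<lambda>x. u x ^ i * v x ^ (m - i))"
    if "i \<le> m" for i
    using that by (metis le_add_diff_inverse)
  have "p = (\<lambda>x. \<Sum>i\<le>m. a i * (u x ^ i * v x ^ (m - i)))"
    by (simp add: a fun_eq_iff mult.assoc)
  then show ?thesis
    by (simp only:) (intro binary_form_sum binary_form_cmult monomial, simp)
qed

section \<open>The complex coordinate and the unit circle\<close>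

definition complex_coord :: "real ^ 2 \<Rightarrow> complex" where
  "complex_coord x = Complex (x $ 1) (x $ 2)"

lemma complex_coord_plane [simp]: "complex_coord (plane w) = w"
  by (simp add: complex_coord_def plane_def complex_eq_iff)

lemma plane_complex_coord [simp]: "plane (complex_coord x) = x"
  by (simp add: complex_coord_def plane_def vec_eq_iff forall_2)

lemma bounded_linear_plane: "bounded_linear plane"
  unfolding plane_def
  by (rule linear_conv_bounded_linear[THEN iffD1], rule linearI)
    (simp_all add: vec_eq_iff forall_2)

lemma norm_plane [simp]: "norm (plane w) = norm w"
  by (simp add: norm_vec_def L2_set_def sum_2 plane_def cmod_def)

lemma norm_complex_coord [simp]: "norm (complex_coord x) = norm x"
  by (metis norm_plane plane_complex_coord)

lemma inner_plane_cis: "plane (cis a) \<bullet> plane (cis b) = cos (a - b)"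
  by (simp add: inner_vec_def sum_2 plane_def cos_diff)

lemma plane_cis_in_S1 [simp]: "plane (cis t) \<in> S1"
  by simp

lemma S1_obtain_angle:
  assumes "\<omega> \<in> S1"
  obtains t where "\<omega> = plane (cis t)"
proof -
  have "norm (complex_coord \<omega>) = 1"
    using assms by simp
  then obtain t where "complex_coord \<omega> = cis t"
    by (metis complex_norm_eq_1_exp cis_conv_exp)
  then show ?thesis
    using that by (metis plane_complex_coord)
qed

lemma complex_coord_add_scaleR:
  "complex_coord (x + t *\<^sub>R y) = complex_coord x + of_real t * complex_coord y"
  by (simp add: complex_coord_def complex_eq_iff)

section \<open>Derivatives and Laplacian in w and cnj w\<close>

text \<open>The product rule with w and cnj w treated as independent variables. The truncated
  exponents at \<open>j = 0\<close> and \<open>l = 0\<close> are harmless, since the factors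
  \<open>of_nat j\<close> and \<open>of_nat l\<close> vanish there.\<close>

lemma has_vector_derivative_monomial:
  "((\<lambda>t. complex_coord (x + t *\<^sub>R y) ^ j * cnj (complex_coord (x + t *\<^sub>R y)) ^ l)
     has_vector_derivative
       complex_coord y * (of_nat j * complex_coord x ^ (j - 1) * cnj (complex_coord x) ^ l)
     + cnj (complex_coord y) * (of_nat l * complex_coord x ^ j * cnj (complex_coord x) ^ (l - 1)))
   (at 0)"
proof -
  define w e where "w = complex_coord x" and "e = complex_coord y"
  \<comment> \<open>For real s the conjugate of w + s e is cnj w + s cnj e. This form is polynomial
    in s, so it can be differentiated over the complex numbers and then restricted to the real
    line.\<close>
  have "((\<lambda>s. (w + s * e) ^ j * (cnj w + s * cnj e) ^ l) has_field_derivative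
      e * (of_nat j * w ^ (j - 1) * cnj w ^ l) + cnj e * (of_nat l * w ^ j * cnj w ^ (l - 1)))
      (at (of_real 0))"
    by (auto intro!: derivative_eq_intros simp: algebra_simps)
  from has_vector_derivative_real_field[OF this] show ?thesis
    by (simp add: complex_coord_add_scaleR w_def e_def)
qed

lemma partial_deriv_monomial_sum:
  "partial_deriv i (\<lambda>x. \<Sum>k\<in>A. b k * (complex_coord x ^ f k * cnj (complex_coord x) ^ g k)) =
    (\<lambda>x. \<Sum>k\<in>A. b k *
      (complex_coord (axis i 1) *
         (of_nat (f k) * complex_coord x ^ (f k - 1) * cnj (complex_coord x) ^ g k)
     + cnj (complex_coord (axis i 1)) *
         (of_nat (g k) * complex_coord x ^ f k * cnj (complex_coord x) ^ (g k - 1))))"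
  unfolding partial_deriv_def fun_eq_iff
  by (intro allI vector_derivative_at has_vector_derivative_sum has_vector_derivative_mult_right
      has_vector_derivative_monomial)

text \<open>In the coordinates \<open>w\<close> and \<open>cnj w\<close> the Laplacian is four times the mixed derivative.\<close>
lemma laplacian_monomial_sum:
  "laplacian (\<lambda>x. \<Sum>k\<in>A. b k * (complex_coord x ^ f k * cnj (complex_coord x) ^ g k)) x =
    (\<Sum>k\<in>A. 4 * of_nat (f k) * of_nat (g k) * b k *
      (complex_coord x ^ (f k - 1) * cnj (complex_coord x) ^ (g k - 1)))"
proof -
  define w where "w = complex_coord x"
  have second: "partial_deriv i (partial_deriv i
        (\<lambda>x. \<Sum>k\<in>A. b k * (complex_coord x ^ f k * cnj (complex_coord x) ^ g k))) x =
      (\<Sum>k\<in>A. b k *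
        (e * (of_nat (f k) * (e * (of_nat (f k - 1) * w ^ (f k - 1 - 1) * cnj w ^ g k)
            + cnj e * (of_nat (g k) * w ^ (f k - 1) * cnj w ^ (g k - 1))))
        + cnj e * (of_nat (g k) * (e * (of_nat (f k) * w ^ (f k - 1) * cnj w ^ (g k - 1))
            + cnj e * (of_nat (g k - 1) * w ^ f k * cnj w ^ (g k - 1 - 1))))))"
    if "e = complex_coord (axis i 1)" for i e
    unfolding partial_deriv_monomial_sum unfolding partial_deriv_def w_def that mult.assoc
    by (intro vector_derivative_at has_vector_derivative_sum has_vector_derivative_mult_right
        has_vector_derivative_add
        has_vector_derivative_monomial[unfolded mult.assoc])
  \<comment> \<open>For e = 1 and e = i the squares e^2 cancel, as do those of cnj e, which removes
    the pure second derivatives. Since e * cnj e = 1 for both, two mixed terms per direction give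
    the factor 4.\<close>
  have "complex_coord (axis 1 1) = 1" "complex_coord (axis 2 1) = \<i>"
    by (simp_all add: complex_coord_def axis_def complex_eq_iff)
  then show ?thesis
    unfolding laplacian_def sum_2 second[OF refl] sum.distrib[symmetric]
    by (intro sum.cong) (simp_all add: w_def algebra_simps)
qed

section \<open>Harmonic homogeneous polynomials\<close>

lemma homogeneous_polynomial_complex_coord:
  assumes "homogeneous_polynomial m p"
  obtains b where
    "p = (\<lambda>x. \<Sum>i\<le>m. b i * (complex_coord x ^ i * cnj (complex_coord x) ^ (m - i)))"
proof -
  have "binary_form m complex_coord (\<lambda>x. cnj (complex_coord x)) p"
    \<comment> \<open>The coefficients come from x1 = (w + cnj w) / 2 and x2 = (w - cnj w) / (2
      i).\<close>
    by (rule binary_form_change_of_variables[OF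
          assms[unfolded homogeneous_polynomial_iff_binary_form],
          where \<alpha> = "1 / 2" and \<beta> = "1 / 2" and \<gamma> = "- (\<i> / 2)" and \<delta> = "\<i> / 2"])
      (simp_all add: complex_coord_def complex_eq_iff)
  then show ?thesis
    using that by (auto simp: binary_form_def fun_eq_iff mult.assoc)
qed

lemma homogeneous_polynomial_monomial:
  "homogeneous_polynomial m (\<lambda>x. c * complex_coord x ^ m)"
  "homogeneous_polynomial m (\<lambda>x. c * cnj (complex_coord x) ^ m)"
proof -
  have w: "binary_form m complex_coord (\<lambda>x. cnj (complex_coord x)) (\<lambda>x. c * complex_coord x ^ m)"
    by (rule binary_formI[where a = "\<lambda>i. if i = m then c else 0"])
      (simp add: if_distrib if_distribR cong: if_cong)
  have cnj_w: "binary_form m complex_coord (\<lambda>x. cnj (complex_coord x))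
      (\<lambda>x. c * cnj (complex_coord x) ^ m)"
    by (rule binary_formI[where a = "\<lambda>i. if i = 0 then c else 0"])
      (simp add: if_distrib if_distribR cong: if_cong)
  have "complex_coord x = 1 * of_real (x $ 1) + \<i> * of_real (x $ 2)"
    "cnj (complex_coord x) = 1 * of_real (x $ 1) + (- \<i>) * of_real (x $ 2)" for x
    by (simp_all add: complex_coord_def complex_eq_iff)
  then show "homogeneous_polynomial m (\<lambda>x. c * complex_coord x ^ m)"
    "homogeneous_polynomial m (\<lambda>x. c * cnj (complex_coord x) ^ m)"
    unfolding homogeneous_polynomial_iff_binary_form
    by (rule binary_form_change_of_variables[OF w] binary_form_change_of_variables[OF cnj_w])+
qed

lemma laplacian_monomial:
  "laplacian (\<lambda>x. c * complex_coord x ^ m) x = 0"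
  "laplacian (\<lambda>x. c * cnj (complex_coord x) ^ m) x = 0"
  \<comment> \<open>One-term sums in which one of the two exponents is 0, which annihilates the
    mixed derivative.\<close>
  using laplacian_monomial_sum[of "\<lambda>_. c" "\<lambda>_. m" "\<lambda>_. 0" "{()}" x]
    laplacian_monomial_sum[of "\<lambda>_. c" "\<lambda>_. 0" "\<lambda>_. m" "{()}" x]
  by simp_all

lemma infinite_unit_circle: "infinite {u :: complex. norm u = 1}"
proof
  assume "finite {u :: complex. norm u = 1}"
  moreover have "inj_on cis {0..<2 * pi}"
    by (rule inj_onI) (metis Arg2pi_unique atLeastLessThan_iff cis_conv_exp zero_less_one)
  moreover have "cis ` {0..<2 * pi} \<subseteq> {u. norm u = 1}"
    by auto
  ultimately have "finite {0..<2 * pi}"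
    using finite_imageD finite_subset by blast
  then show False
    using infinite_Ico[of 0 "2 * pi"] by simp
qed

text \<open>On the unit circle \<open>w\<^sup>m * w ^ (i - 1) * cnj w ^ (m - i - 1) = (w\<^sup>2) ^ i\<close>, so the vanishing of
  the Laplacian there is the vanishing of a polynomial in \<open>w\<^sup>2\<close>.\<close>
lemma harmonic_coefficients_zero:
  assumes "\<And>x. laplacian
      (\<lambda>x. \<Sum>i\<le>m. b i * (complex_coord x ^ i * cnj (complex_coord x) ^ (m - i))) x = 0"
    and "0 < i" "i < m"
  shows "b i = 0"
proof -
  \<comment> \<open>The factors i and m - i vanish at both ends, where the truncated exponents would
    spoil the power identity. They are nonzero strictly between, so \<open>b i\<close> can be
    recovered from \<open>c i\<close>.\<close>
  define c :: "nat \<Rightarrow> complex" where "c i = 4 * of_nat i * of_nat (m - i) * b i" for i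
  have "(\<Sum>i\<le>m. c i * u ^ i) = 0" if u: "norm u = 1" for u
  proof -
    \<comment> \<open>A square root makes every unit \<open>u\<close> the square of a point of the
      circle, so the polynomial in w^2 has infinitely many roots.\<close>
    define w where "w = csqrt u"
    have w: "w\<^sup>2 = u" "w * cnj w = 1"
      using u by (simp_all add: w_def complex_norm_square[symmetric] norm_csqrt)
    have "c i * u ^ i = w ^ m * (c i * (w ^ (i - 1) * cnj w ^ (m - i - 1)))" if "i \<le> m" for i
    proof (cases "i = 0 \<or> i = m")
      case True
      then show ?thesis by (auto simp: c_def)
    next
      case False
      define d n where "d = i - 1" and "n = m - i - 1"
      then have d: "i = Suc d" "m = Suc d + Suc n"
        using False that by auto
      have "w ^ (Suc d + Suc n) * (w ^ d * cnj w ^ n) = (w\<^sup>2) ^ Suc d * (w * cnj w) ^ n"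
        by (simp add: power_mult_distrib power_add power2_eq_square mult_ac)
      then have "w ^ m * (w ^ d * cnj w ^ n) = u ^ i"
        by (simp only: w d power_one mult_1_right)
      then show ?thesis
        unfolding d_def n_def by (metis mult.left_commute)
    qed
    then have "(\<Sum>i\<le>m. c i * u ^ i) =
        w ^ m * (\<Sum>i\<le>m. c i * (w ^ (i - 1) * cnj w ^ (m - i - 1)))"
      unfolding sum_distrib_left by (intro sum.cong) simp_all
    also have "\<dots> = 0"
      using assms(1)[of "plane w"] by (simp add: laplacian_monomial_sum c_def)
    finally show ?thesis .
  qed
  then have "infinite {u. (\<Sum>i\<le>m. c i * u ^ i) = 0}"
    using infinite_unit_circle by (metis (mono_tags, lifting) Collect_mono rev_finite_subset)
  then have "c i = 0"
    using polyfun_finite_roots[of c m] assms(3) by auto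
  then show ?thesis
    using assms(2,3) by (simp add: c_def)
qed

section \<open>Spherical harmonics as exponentials\<close>

text \<open>The normalised Fourier exponentials. For negative \<open>k\<close> a power of the
  conjugate is used instead of a negative power, so that the function is the restriction of a
  polynomial.\<close>

definition circle_harmonic :: "int \<Rightarrow> real ^ 2 \<Rightarrow> complex" where
  "circle_harmonic k = restrict
    (\<lambda>x. 1 / of_real (sqrt (2 * pi)) *
      (if k \<ge> 0 then complex_coord x else cnj (complex_coord x)) ^ nat \<bar>k\<bar>) S1"

lemma circle_harmonic_cis:
  "circle_harmonic k (plane (cis t)) = cis (of_int k * t) / of_real (sqrt (2 * pi))"
  by (simp add: circle_harmonic_def Complex.DeMoivre cis_cnj)

lemma circle_harmonic_in_spherical_harmonics:
  assumes "nat \<bar>k\<bar> = m"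
  shows "circle_harmonic k \<in> spherical_harmonics m"
proof -
  let ?h = "\<lambda>x. 1 / of_real (sqrt (2 * pi)) *
      (if k \<ge> 0 then complex_coord x else cnj (complex_coord x)) ^ m"
  have "homogeneous_polynomial m ?h" "laplacian ?h x = 0" for x
    using homogeneous_polynomial_monomial laplacian_monomial by (cases "k \<ge> 0"; simp only: if_True if_False)+
  then show ?thesis
    unfolding circle_harmonic_def spherical_harmonics_def assms by blast
qed

text \<open>By \<open>harmonic_coefficients_zero\<close> only the extreme coefficients survive:
  \<open>b m\<close> at w^m and \<open>b 0\<close> at cnj w^m.\<close>

lemma spherical_harmonics_expansion:
  assumes "h \<in> spherical_harmonics m"
  shows "\<exists>c. \<forall>t. h (plane (cis t)) =
    (\<Sum>k\<in>{int m, - int m}. c k * circle_harmonic k (plane (cis t)))"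
proof -
  obtain p where p: "h = restrict p S1" "homogeneous_polynomial m p" "\<And>x. laplacian p x = 0"
    using assms by (auto simp: spherical_harmonics_def)
  obtain b where b:
    "p = (\<lambda>x. \<Sum>i\<le>m. b i * (complex_coord x ^ i * cnj (complex_coord x) ^ (m - i)))"
    using homogeneous_polynomial_complex_coord[OF p(2)] .
  have zero: "b i = 0" if "0 < i" "i < m" for i
    using harmonic_coefficients_zero[OF p(3)[unfolded b] that] .
  define c where "c k = of_real (sqrt (2 * pi)) * (if k \<ge> 0 then b m else b 0)" for k :: int
  have "h (plane (cis t)) =
      (\<Sum>k\<in>{int m, - int m}. c k * circle_harmonic k (plane (cis t)))" for t
  proof -
    have "h (plane (cis t)) = (\<Sum>i\<le>m. b i * (cis t ^ i * cnj (cis t) ^ (m - i)))"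
      by (simp add: p(1) b)
    also have "\<dots> = (\<Sum>i\<in>{0, m}. b i * (cis t ^ i * cnj (cis t) ^ (m - i)))"
      by (rule sum.mono_neutral_right) (use zero in auto)
    also have "\<dots> = (\<Sum>k\<in>{int m, - int m}. c k * circle_harmonic k (plane (cis t)))"
      \<comment> \<open>For \<open>m = 0\<close> both index sets collapse to a single
        element.\<close>
      by (cases "m = 0") (simp_all add: c_def circle_harmonic_cis Complex.DeMoivre cis_cnj)
    finally show ?thesis .
  qed
  then show ?thesis by blast
qed

lemma spherical_harmonics_continuous:
  assumes "h \<in> spherical_harmonics m"
  shows "continuous_on A (\<lambda>t. h (plane (cis t)))"
proof -
  obtain c where "\<forall>t. h (plane (cis t)) =
      (\<Sum>k\<in>{int m, - int m}. c k * circle_harmonic k (plane (cis t)))"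
    using spherical_harmonics_expansion[OF assms] by blast
  then show ?thesis
    by (simp only: circle_harmonic_cis) (auto simp: cis_conv_exp intro!: continuous_intros)
qed

section \<open>The inner product and the reproducing kernel\<close>

text \<open>Off the circle \<open>restrict\<close> yields the constant \<open>undefined\<close>, so
  \<open>h\<close> is a continuous function on a closed set glued to a constant.\<close>

lemma spherical_harmonics_measurable:
  assumes "h \<in> spherical_harmonics m"
  shows "h \<in> borel_measurable borel"
proof -
  obtain p where p: "h = restrict p S1" "homogeneous_polynomial m p"
    using assms by (auto simp: spherical_harmonics_def)
  obtain a where "p = (\<lambda>x. \<Sum>i\<le>m. a i * of_real (x $ 1) ^ i * of_real (x $ 2) ^ (m - i))"
    using p(2) by (auto simp: homogeneous_polynomial_def)
  then have "continuous_on UNIV p"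
    by (simp only:) (intro continuous_intros)
  then have [measurable]: "p \<in> borel_measurable borel"
    by (rule borel_measurable_continuous_onI)
  have [measurable]: "S1 \<in> sets borel"
    by (simp add: borel_closed)
  show ?thesis
    unfolding p(1) restrict_def by measurable
qed

lemma L2_inner_eq_integral:
  assumes "f \<in> spherical_harmonics m" "g \<in> spherical_harmonics m"
  shows "L2_inner f g = (LBINT t:{0..<2 * pi}. f (plane (cis t)) * cnj (g (plane (cis t))))"
proof -
  have [measurable]: "f \<in> borel_measurable borel" "g \<in> borel_measurable borel"
    using assms spherical_harmonics_measurable by auto
  have "continuous_on UNIV (\<lambda>t. plane (cis t))"
    using bounded_linear.continuous_on[OF bounded_linear_plane, of UNIV cis]
    by (simp add: cis_conv_exp continuous_intros)
  then have "(\<lambda>t. plane (cis t)) \<in> borel_measurable borel"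
    by (rule borel_measurable_continuous_onI)
  then have [measurable]: "(\<lambda>t. plane (cis t)) \<in>
      measurable (restrict_space lborel {0..<2 * pi}) borel"
    by (intro measurable_restrict_space1) simp
  have "cnj \<in> borel_measurable borel"
    by (intro borel_measurable_continuous_onI continuous_intros)
  then have [measurable]: "(\<lambda>\<omega>. cnj (g \<omega>)) \<in> borel_measurable borel"
    by (rule measurable_compose[rotated]) measurable
  show ?thesis
    unfolding L2_inner_def arc_length_def set_lebesgue_integral_def
    by (subst integral_distr) (simp_all add: integral_restrict_space)
qed

lemma L2_inner_integrable:
  assumes "f \<in> spherical_harmonics m" "g \<in> spherical_harmonics m"
  shows "set_integrable lborel {0..<2 * pi} (\<lambda>t. f (plane (cis t)) * cnj (g (plane (cis t))))"
proof (rule set_integrable_subset)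
  show "set_integrable lborel {0..2 * pi} (\<lambda>t. f (plane (cis t)) * cnj (g (plane (cis t))))"
    using assms
    by (intro borel_integrable_atLeastAtMost' continuous_intros spherical_harmonics_continuous)
qed auto

lemma L2_inner_cnj: "cnj (L2_inner f g) = L2_inner g f"
  unfolding L2_inner_def by (subst Bochner_Integration.integral_cnj [symmetric]) (simp add: mult.commute)

text \<open>The definition of a basis supplies some coefficients \<open>c\<close>; integrating the
  expansion against \<open>q\<close> isolates \<open>c q\<close> by orthonormality.\<close>

lemma orthonormal_basis_expansion:
  assumes "orthonormal_basis m B" "h \<in> spherical_harmonics m" "\<omega> \<in> S1"
  shows "h \<omega> = (\<Sum>p\<in>B. L2_inner h p * p \<omega>)"
proof -
  have B: "finite B" "\<And>p. p \<in> B \<Longrightarrow> p \<in> spherical_harmonics m"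
    "\<And>p q. p \<in> B \<Longrightarrow> q \<in> B \<Longrightarrow> L2_inner p q = (if p = q then 1 else 0)"
    using assms(1) by (auto simp: orthonormal_basis_def)
  obtain c where c: "\<And>\<omega>. \<omega> \<in> S1 \<Longrightarrow> h \<omega> = (\<Sum>p\<in>B. c p * p \<omega>)"
    using assms by (auto simp: orthonormal_basis_def)
  have "L2_inner h q = c q" if q: "q \<in> B" for q
  proof -
    have "L2_inner h q = (LBINT t:{0..<2 * pi}.
        (\<Sum>p\<in>B. c p * (p (plane (cis t)) * cnj (q (plane (cis t))))))"
      using L2_inner_eq_integral[OF assms(2) B(2)[OF q]]
      by (simp add: c sum_distrib_right mult.assoc)
    also have "\<dots> = (\<Sum>p\<in>B. LBINT t:{0..<2 * pi}.
        c p * (p (plane (cis t)) * cnj (q (plane (cis t)))))"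
      unfolding set_lebesgue_integral_def scaleR_sum_right
      by (intro Bochner_Integration.integral_sum
          set_integrable_mult_right[unfolded set_integrable_def]
          L2_inner_integrable[OF B(2) B(2)[OF q], unfolded set_integrable_def])
    also have "\<dots> = (\<Sum>p\<in>B. c p * L2_inner p q)"
      using L2_inner_eq_integral[OF B(2) B(2)[OF q]] by simp
    also have "\<dots> = (\<Sum>p\<in>B. if p = q then c p else 0)"
      using B(3) q by (intro sum.cong) auto
    also have "\<dots> = c q"
      using B(1) q by simp
    finally show ?thesis .
  qed
  then show ?thesis
    using c[OF assms(3)] by simp
qed

text \<open>Expand each \<open>p\<close> in the basis \<open>C\<close> and swap the sums. Hermitian
  symmetry moves the coefficients under the conjugate, where the sum over \<open>B\<close> is the
  expansion of \<open>q\<close> at \<open>\<omega>'\<close>.\<close>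

lemma reproducing_kernel_unique:
  assumes B: "orthonormal_basis m B" and C: "orthonormal_basis m C" and "\<omega> \<in> S1" "\<omega>' \<in> S1"
  shows "(\<Sum>p\<in>B. p \<omega> * cnj (p \<omega>')) = (\<Sum>q\<in>C. q \<omega> * cnj (q \<omega>'))"
proof -
  have B_mem: "p \<in> spherical_harmonics m" if "p \<in> B" for p
    using B that by (auto simp: orthonormal_basis_def)
  have C_mem: "q \<in> spherical_harmonics m" if "q \<in> C" for q
    using C that by (auto simp: orthonormal_basis_def)
  have "(\<Sum>p\<in>B. p \<omega> * cnj (p \<omega>')) = (\<Sum>p\<in>B. (\<Sum>q\<in>C. L2_inner p q * q \<omega>) * cnj (p \<omega>'))"
    using orthonormal_basis_expansion[OF C B_mem \<open>\<omega> \<in> S1\<close>] by simp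
  also have "\<dots> = (\<Sum>q\<in>C. \<Sum>p\<in>B. L2_inner p q * q \<omega> * cnj (p \<omega>'))"
    by (simp add: sum_distrib_right sum.swap[of _ C B])
  also have "\<dots> = (\<Sum>q\<in>C. q \<omega> * cnj (\<Sum>p\<in>B. L2_inner q p * p \<omega>'))"
    by (simp add: L2_inner_cnj sum_distrib_left mult_ac)
  also have "\<dots> = (\<Sum>q\<in>C. q \<omega> * cnj (q \<omega>'))"
    using orthonormal_basis_expansion[OF B C_mem \<open>\<omega>' \<in> S1\<close>] by simp
  finally show ?thesis .
qed

section \<open>Orthonormality of the exponentials\<close>

lemma integral_cis_int:
  "(LBINT t:{0..<2 * pi}. cis (of_int k * t)) = (if k = 0 then 2 * of_real pi else 0)"
proof -
  have int: "set_integrable lborel {0..2 * pi} (\<lambda>t. cis (of_int k * t))"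
    by (intro borel_integrable_atLeastAtMost') (auto simp: cis_conv_exp intro!: continuous_intros)
  then have "set_integrable lborel {0..<2 * pi} (\<lambda>t. cis (of_int k * t))"
    by (rule set_integrable_subset) auto
  then have "(LBINT t:{0..<2 * pi}. cis (of_int k * t)) = integral {0..<2 * pi} (\<lambda>t. cis (of_int k * t))"
    by (rule set_borel_integral_eq_integral)
  also have "\<dots> = integral {0..2 * pi} (\<lambda>t. cis (of_int k * t))"
    \<comment> \<open>The intervals differ by the single point \<open>2 * pi\<close>; the closed one
      suits the fundamental theorem of calculus.\<close>
    by (rule integral_subset_negligible, force)
      (rule negligible_subset[of "{2 * pi}"], auto)
  also have "\<dots> = (if k = 0 then 2 * of_real pi else 0)"
  proof (cases "k = 0")
    case True
    then show ?thesis
      by (simp add: scaleR_conv_of_real)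
  next
    case False
    \<comment> \<open>The antiderivative takes the same value at both endpoints by periodicity, so
      the difference is 0.\<close>
    have "((\<lambda>t. cis (of_int k * t)) has_integral
        cis (of_int k * (2 * pi)) / (\<i> * of_int k) - cis (of_int k * 0) / (\<i> * of_int k)) {0..2 * pi}"
    proof (rule fundamental_theorem_of_calculus)
      fix t :: real
      have "((\<lambda>s. exp (\<i> * of_int k * s) / (\<i> * of_int k)) has_field_derivative
          exp (\<i> * of_int k * of_real t)) (at (of_real t))"
        using False by (auto intro!: derivative_eq_intros)
      from has_vector_derivative_real_field[OF this]
      show "((\<lambda>t. cis (of_int k * t) / (\<i> * of_int k)) has_vector_derivative cis (of_int k * t))
          (at t within {0..2 * pi})"
        by (simp add: cis_conv_exp mult.assoc)
    qed simp
    moreover have "cis (of_int k * (2 * pi)) = 1"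
      using cis_multiple_2pi[of "of_int k"] by (simp add: mult_ac)
    ultimately show ?thesis
      using False by (simp add: integral_unique)
  qed
  finally show ?thesis .
qed

lemma sqrt_2pi_mult_self:
  "complex_of_real (sqrt (2 * pi)) * complex_of_real (sqrt (2 * pi)) = 2 * of_real pi"
  by (subst of_real_mult[symmetric]) simp

lemma L2_inner_circle_harmonic:
  assumes "nat \<bar>k\<bar> = m" "nat \<bar>l\<bar> = m"
  shows "L2_inner (circle_harmonic k) (circle_harmonic l) = (if k = l then 1 else 0)"
proof -
  have "circle_harmonic k (plane (cis t)) * cnj (circle_harmonic l (plane (cis t))) =
      cis (of_int (k - l) * t) / (2 * of_real pi)" for t
    by (simp add: circle_harmonic_cis cis_cnj cis_mult left_diff_distrib sqrt_2pi_mult_self)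
  then have "L2_inner (circle_harmonic k) (circle_harmonic l) =
      (LBINT t:{0..<2 * pi}. cis (of_int (k - l) * t)) / (2 * of_real pi)"
    using L2_inner_eq_integral[OF circle_harmonic_in_spherical_harmonics[OF assms(1)]
        circle_harmonic_in_spherical_harmonics[OF assms(2)]]
    by simp
  then show ?thesis
    unfolding integral_cis_int by simp
qed

text \<open>Two equal functions of distinct index would have inner product both 0 and 1. Injectivity
  lets sums over the basis be reindexed by \<open>k\<close>.\<close>

lemma inj_on_circle_harmonic: "inj_on circle_harmonic {int m, - int m}"
proof (rule inj_onI)
  fix k l assume kl: "k \<in> {int m, - int m}" "l \<in> {int m, - int m}"
    and eq: "circle_harmonic k = circle_harmonic l"
  have "L2_inner (circle_harmonic k) (circle_harmonic l) =
      L2_inner (circle_harmonic k) (circle_harmonic k)"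
    using eq by simp
  with kl show "k = l"
    by (subst (asm) (1 2) L2_inner_circle_harmonic[where m = m]) (auto split: if_splits)
qed

lemma orthonormal_basis_circle_harmonic:
  "orthonormal_basis m (circle_harmonic ` {int m, - int m})"
proof -
  have "\<exists>c. \<forall>\<omega>\<in>S1. h \<omega> = (\<Sum>p\<in>circle_harmonic ` {int m, - int m}. c p * p \<omega>)"
    if h: "h \<in> spherical_harmonics m" for h
  proof -
    obtain c where c: "\<And>t. h (plane (cis t)) =
        (\<Sum>k\<in>{int m, - int m}. c k * circle_harmonic k (plane (cis t)))"
      using spherical_harmonics_expansion[OF h] by blast
    show ?thesis
    proof (intro exI ballI)
      fix \<omega> :: "real ^ 2" assume "\<omega> \<in> S1"
      then obtain t where t: "\<omega> = plane (cis t)"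
        by (rule S1_obtain_angle)
      \<comment> \<open>Coefficients must be indexed by basis functions, so \<open>inv_into\<close>
        reads the frequency off the function.\<close>
      show "h \<omega> = (\<Sum>p\<in>circle_harmonic ` {int m, - int m}.
          c (inv_into {int m, - int m} circle_harmonic p) * p \<omega>)"
        unfolding sum.reindex[OF inj_on_circle_harmonic] t c
        by (intro sum.cong) (simp_all only: o_def inv_into_f_f[OF inj_on_circle_harmonic])
    qed
  qed
  moreover have "\<forall>k\<in>{int m, - int m}. \<forall>l\<in>{int m, - int m}.
      L2_inner (circle_harmonic k) (circle_harmonic l) =
        (if circle_harmonic k = circle_harmonic l then 1 else 0)"
    using L2_inner_circle_harmonic[where m = m] inj_on_circle_harmonic[of m]
    by (auto simp: inj_on_def)
  moreover have "circle_harmonic ` {int m, - int m} \<subseteq> spherical_harmonics m"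
    by (auto intro: circle_harmonic_in_spherical_harmonics)
  ultimately show ?thesis
    unfolding orthonormal_basis_def by blast
qed

section \<open>The zonal kernel\<close>

lemma P0_cis:
  "P0 m (plane (cis a)) (plane (cis b)) = (\<Sum>k\<in>{int m, - int m}. cis (of_int k * (a - b)))"
proof -
  let ?B = "circle_harmonic ` {int m, - int m}"
  let ?S = "\<lambda>B. 2 * of_real pi * (\<Sum>p\<in>B. p (plane (cis a)) * cnj (p (plane (cis b))))"
  have "P0 m (plane (cis a)) (plane (cis b)) = ?S ?B"
    unfolding P0_def
  \<comment> \<open>The description is well defined because a basis exists and, by
    \<open>reproducing_kernel_unique\<close>, every basis yields the same value.\<close>
  proof (rule the_equality)
    show "\<exists>B. orthonormal_basis m B \<and> ?S ?B = ?S B"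
      using orthonormal_basis_circle_harmonic by blast
    show "v = ?S ?B" if "\<exists>B. orthonormal_basis m B \<and> v = ?S B" for v
      using that reproducing_kernel_unique[OF _ orthonormal_basis_circle_harmonic
          plane_cis_in_S1 plane_cis_in_S1] by auto
  qed
  also have "\<dots> = (\<Sum>k\<in>{int m, - int m}. 2 * of_real pi *
      (circle_harmonic k (plane (cis a)) * cnj (circle_harmonic k (plane (cis b)))))"
    by (simp only: sum.reindex[OF inj_on_circle_harmonic] o_def sum_distrib_left)
  also have "\<dots> = (\<Sum>k\<in>{int m, - int m}. cis (of_int k * (a - b)))"
  proof (rule sum.cong)
    fix k
    show "2 * of_real pi *
        (circle_harmonic k (plane (cis a)) * cnj (circle_harmonic k (plane (cis b)))) =
        cis (of_int k * (a - b))"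
      by (simp add: circle_harmonic_cis cis_cnj cis_mult right_diff_distrib sqrt_2pi_mult_self)
  qed simp
  finally show ?thesis .
qed

text \<open>Any \<open>d\<close> with the right cosine is the angle difference up to sign and full
  turns. Full turns disappear because the frequencies are integers, and the sign because the set of
  frequencies is symmetric. Thus \<open>arccos\<close> and a plain difference of angles are both
  admissible.\<close>

lemma P0_eq:
  assumes "\<omega> \<in> S1" "\<omega>' \<in> S1" "cos d = \<omega> \<bullet> \<omega>'"
  shows "P0 m \<omega> \<omega>' = (\<Sum>k\<in>{int m, - int m}. cis (of_int k * d))"
proof -
  obtain a b where ab: "\<omega> = plane (cis a)" "\<omega>' = plane (cis b)"
    using assms(1,2) by (meson S1_obtain_angle)
  then have "cos d = cos (a - b)"
    using assms(3) by (simp only: inner_plane_cis)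
  then obtain n where "n \<in> \<int>" "d = (a - b) + 2 * n * pi \<or> d = - (a - b) + 2 * n * pi"
    unfolding cos_eq by blast
  then obtain n :: int where n: "d = (a - b) + 2 * of_int n * pi \<or> d = - (a - b) + 2 * of_int n * pi"
    by (auto elim: Ints_cases)
  have period: "cis (of_int k * (s + 2 * of_int n * pi)) = cis (of_int k * s)" for k s
  proof -
    have "cis (of_int k * (s + 2 * of_int n * pi)) = cis (of_int k * s) * cis (2 * pi * of_int (k * n))"
      by (simp add: cis_mult algebra_simps)
    then show ?thesis
      by (simp add: cis_multiple_2pi)
  qed
  have "(\<Sum>k\<in>{int m, - int m}. cis (of_int k * d)) =
      (\<Sum>k\<in>{int m, - int m}. cis (of_int k * (a - b)))"
    using n
  proof
    assume d: "d = (a - b) + 2 * of_int n * pi"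
    show ?thesis
      unfolding d period ..
  next
    assume d: "d = - (a - b) + 2 * of_int n * pi"
    show ?thesis
      unfolding d period
      by (rule sum.reindex_bij_witness[of _ uminus uminus]) (auto simp: algebra_simps)
  qed
  then show ?thesis
    by (simp only: ab P0_cis)
qed

section \<open>The theta series\<close>

text \<open>Since m <= m^2, the terms are dominated by a geometric series of ratio exp(- Re z) <
  1.\<close>

lemma summable_theta_terms:
  assumes "Re z > 0"
  shows "summable (\<lambda>m. norm (exp (- (z * of_nat m ^ 2))))"
proof (rule summable_comparison_test_ev)
  show "summable (\<lambda>m. exp (- Re z) ^ m)"
    using assms by (intro summable_geometric) simp
  show "\<forall>\<^sub>F m in sequentially. norm (norm (exp (- (z * of_nat m ^ 2)))) \<le> exp (- Re z) ^ m"
  proof (intro always_eventually allI)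
    fix m :: nat
    have "real m \<le> (real m)\<^sup>2"
      by (simp add: power2_eq_square flip: of_nat_mult)
    then have "Re z * real m \<le> Re z * (real m)\<^sup>2"
      using assms by simp
    then show "norm (norm (exp (- (z * of_nat m ^ 2)))) \<le> exp (- Re z) ^ m"
      by (simp add: power2_eq_square mult.commute flip: exp_of_nat_mult of_nat_mult)
  qed
qed

text \<open>Groups the integers by absolute value; the fibre over 0 is a singleton, so 0 is counted
  once.\<close>

lemma bij_betw_int_by_abs:
  "bij_betw snd (Sigma (UNIV :: nat set) (\<lambda>m. {int m, - int m})) (UNIV :: int set)"
  by (rule bij_betw_byWitness[where f' = "\<lambda>k. (nat \<bar>k\<bar>, k)"]) auto

text \<open>Absolute summability over the pairs (|k|, k) permits summing the theta series fibre by
  fibre.\<close>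

lemma theta_eq_suminf:
  assumes "Re z > 0"
  shows "theta (of_real (1 / (2 * pi) * d)) (\<i> / of_real pi * z) =
    (\<Sum>m. exp (- (z * of_nat m ^ 2)) * (\<Sum>k\<in>{int m, - int m}. cis (of_int k * d)))"
proof -
  define F where "F k = exp (- (z * of_int k ^ 2)) * cis (of_int k * d)" for k :: int
  define G where "G m = (\<Sum>k\<in>{int m, - int m}. F k)" for m :: nat
  have G: "G m = exp (- (z * of_nat m ^ 2)) * (\<Sum>k\<in>{int m, - int m}. cis (of_int k * d))" for m
    unfolding G_def sum_distrib_left by (intro sum.cong) (auto simp: F_def)
  \<comment> \<open>A fibre has at most two elements, and \<open>cis\<close> has norm 1; hence the
    bound with factor 2.\<close>
  have "(\<lambda>m. 2 * norm (exp (- (z * of_nat m ^ 2)))) summable_on UNIV"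
    using summable_theta_terms[OF assms] by (intro summable_nonneg_imp_summable_on summable_mult) auto
  then have "(\<lambda>m. \<Sum>\<^sub>\<infinity>k\<in>{int m, - int m}. norm (F k)) summable_on UNIV"
  proof (rule summable_on_comparison_test)
    fix m :: nat
    show "(\<Sum>\<^sub>\<infinity>k\<in>{int m, - int m}. norm (F k)) \<le> 2 * norm (exp (- (z * of_nat m ^ 2)))"
      by (cases "m = 0") (simp_all add: F_def norm_mult)
    show "0 \<le> (\<Sum>\<^sub>\<infinity>k\<in>{int m, - int m}. norm (F k))"
      by (intro infsum_nonneg) simp
  qed
  then have "(\<lambda>m. norm (\<Sum>\<^sub>\<infinity>k\<in>{int m, - int m}. norm (F k))) summable_on UNIV"
    by (simp only: real_norm_def abs_of_nonneg infsum_nonneg norm_ge_zero)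
  then have "(\<lambda>x. norm (F (snd x))) summable_on Sigma UNIV (\<lambda>m. {int m, - int m})"
    by (subst Infinite_Sum.abs_summable_on_Sigma_iff) auto
  then have "(\<lambda>x. F (snd x)) summable_on Sigma UNIV (\<lambda>m. {int m, - int m})"
    by (rule abs_summable_summable)
  then have "((\<lambda>x. F (snd x)) has_sum infsum F UNIV) (Sigma UNIV (\<lambda>m. {int m, - int m}))"
    using infsum_reindex_bij_betw[OF bij_betw_int_by_abs, of F] by (metis has_sum_infsum)
  then have "(G has_sum infsum F UNIV) UNIV"
    by (rule has_sum_SigmaD) (simp only: G_def snd_conv, intro has_sum_finite, simp)
  then have "infsum F UNIV = (\<Sum>m. G m)"
    by (intro sums_unique has_sum_imp_sums)
  moreover have "theta (of_real (1 / (2 * pi) * d)) (\<i> / of_real pi * z) = infsum F UNIV"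
    unfolding theta_def F_def
  proof (intro infsum_cong)
    fix k :: int
    \<comment> \<open>The arguments of \<open>theta\<close> are scaled so that both factors pi
      cancel.\<close>
    have "\<i> * of_real pi * (\<i> / of_real pi * z) * of_int k ^ 2 +
        2 * \<i> * of_real pi * of_int k * of_real (1 / (2 * pi) * d) =
        - (z * of_int k ^ 2) + \<i> * of_real (of_int k * d)"
      by simp
    then show "exp (\<i> * of_real pi * (\<i> / of_real pi * z) * of_int k ^ 2 +
        2 * \<i> * of_real pi * of_int k * of_real (1 / (2 * pi) * d)) =
        exp (- (z * of_int k ^ 2)) * cis (of_int k * d)"
      by (simp only: cis_conv_exp exp_add)
  qed
  ultimately show ?thesis
    by (simp add: G)
qed

section \<open>The kernel in terms of theta\<close>

lemma K0_eq_theta: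
  assumes "Re z > 0" "r > 0" "r' > 0" "\<omega> \<in> S1" "\<omega>' \<in> S1" "cos d = \<omega> \<bullet> \<omega>'"
  shows "K0 (r *\<^sub>R \<omega>) (r' *\<^sub>R \<omega>') z =
    1 / (2 * of_real pi * csqrt (4 * of_real pi * z)) *
    exp (- (of_real ((ln r - ln r')\<^sup>2) / (4 * z))) *
    theta (of_real (1 / (2 * pi) * d)) (\<i> / of_real pi * z)"
proof -
  have polar: "norm (r *\<^sub>R \<omega>) = r" "norm (r' *\<^sub>R \<omega>') = r'"
    "sgn (r *\<^sub>R \<omega>) = \<omega>" "sgn (r' *\<^sub>R \<omega>') = \<omega>'"
    using assms by (simp_all add: sgn_div_norm)
  show ?thesis
    unfolding K0_def polar P0_eq[OF assms(4-6)] theta_eq_suminf[OF assms(1)] by simp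
qed

theorem proposition4p2:
  fixes z :: complex
  assumes "Re z > 0"
  shows "(\<forall>r r' :: real. \<forall>\<omega>\<in>S1. \<forall>\<omega>'\<in>S1. r > 0 \<longrightarrow> r' > 0 \<longrightarrow>
            K0 (r *\<^sub>R \<omega>) (r' *\<^sub>R \<omega>') z =
              1 / (2 * of_real pi * csqrt (4 * of_real pi * z)) *
              exp (- (of_real ((ln r - ln r')\<^sup>2) / (4 * z))) *
              theta (of_real (1 / (2 * pi) * arccos (\<omega> \<bullet> \<omega>'))) (\<i> / of_real pi * z))
       \<and> (\<forall>r r' \<phi> \<phi>' :: real. r > 0 \<longrightarrow> r' > 0 \<longrightarrow>
            K0 (plane (of_real r * exp (\<i> * of_real \<phi>))) (plane (of_real r' * exp (\<i> * of_real \<phi>'))) z =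
              1 / (2 * of_real pi * csqrt (4 * of_real pi * z)) *
              exp (- (of_real ((ln r - ln r')\<^sup>2) / (4 * z))) *
              theta (of_real (1 / (2 * pi) * (\<phi> - \<phi>'))) (\<i> / of_real pi * z))"
proof (intro conjI allI ballI impI)
  fix r r' :: real and \<omega> \<omega>' :: "real ^ 2"
  assume S1: "\<omega> \<in> S1" "\<omega>' \<in> S1" and r: "r > 0" "r' > 0"
  \<comment> \<open>\<open>cos\<close> undoes \<open>arccos\<close> only on [-1, 1], where
    Cauchy-Schwarz places the inner product.\<close>
  have "\<bar>\<omega> \<bullet> \<omega>'\<bar> \<le> 1"
    using Cauchy_Schwarz_ineq2[of \<omega> \<omega>'] S1 by simp
  then have "cos (arccos (\<omega> \<bullet> \<omega>')) = \<omega> \<bullet> \<omega>'"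
    by (simp add: cos_arccos_abs)
  then show "K0 (r *\<^sub>R \<omega>) (r' *\<^sub>R \<omega>') z =
      1 / (2 * of_real pi * csqrt (4 * of_real pi * z)) *
      exp (- (of_real ((ln r - ln r')\<^sup>2) / (4 * z))) *
      theta (of_real (1 / (2 * pi) * arccos (\<omega> \<bullet> \<omega>'))) (\<i> / of_real pi * z)"
    using K0_eq_theta[OF assms r S1] by blast
next
  fix r r' \<phi> \<phi>' :: real
  assume r: "r > 0" "r' > 0"
  have "plane (of_real s * exp (\<i> * of_real t)) = s *\<^sub>R plane (cis t)" for s t
    by (simp add: plane_def vec_eq_iff forall_2 flip: cis_conv_exp)
  then show "K0 (plane (of_real r * exp (\<i> * of_real \<phi>))) (plane (of_real r' * exp (\<i> * of_real \<phi>'))) z =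
      1 / (2 * of_real pi * csqrt (4 * of_real pi * z)) *
      exp (- (of_real ((ln r - ln r')\<^sup>2) / (4 * z))) *
      theta (of_real (1 / (2 * pi) * (\<phi> - \<phi>'))) (\<i> / of_real pi * z)"
    \<comment> \<open>Here \<open>d\<close> is the angle difference itself, whose cosine is the
      inner product whatever its range.\<close>
    using K0_eq_theta[OF assms r plane_cis_in_S1 plane_cis_in_S1 inner_plane_cis[symmetric]]
    by simp
qed

end
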